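(* Assume that for every fixed $e\in V$ the function $\tilde\psi:\Omega\to V$, defined by $\tilde\psi_\omega := R_\omega T_\omega e/\|R_\omega T_\omega e\|$ if $R_\omega T_\omega e\neq 0$ and $\tilde\psi_\omega:=0$ if $R_\omega T_\omega e=0$, is Bochner-measurable. Then for arbitrary $u\in V$ (the solution of $a(u,v)=F(v)$ for all $v\in V$) the iterates $u^{(m)}$ of the algorithm described in the context satisfy, with $\delta_m^2:=\|u-u^{(m)}\|^2$, $$\mathbb{E}(\delta_m^2)^{1/2}\le 2\left(\|u-h\|+\frac{\left((\Lambda\|h\|_{A_2}+\|h\|)^2+\|u\|^2\right)^{1/2}}{(m+1)^{1/2}}\right),\qquad m=0,1,2,\ldots,$$ where $h\in A_2$ is arbitrary. As a consequence, $\mathbb{E}(\delta_m^2)\to 0$ as $m\to\infty$ if $u$ belongs to the closure of $A_2$ in $V$.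
   Context: Setting. $V$ is a separable real Hilbert space, $a(\cdot,\cdot)$ is a continuous, coercive, symmetric bilinear form on $V$; $V$ is equipped with the (equivalent) scalar product $a(\cdot,\cdot)$ and norm $\|v\|=a(v,v)^{1/2}$. $F$ is a bounded linear functional on $V$ and $u\in V$ is the unique element with $a(u,v)=F(v)$ for all $v\in V$. $\Omega$ is an index set (possibly uncountable) equipped with a probability measure $\rho$. For each $\omega\in\Omega$, $V_\omega$ is a separable real Hilbert space equipped with a (spectrally equivalent) scalar product $a_\omega(\cdot,\cdot)$ and norm $\|v_\omega\|_\omega=a_\omega(v_\omega,v_\omega)^{1/2}$, and $R_\omega:V_\omega\to V$ is a linear operator with $\mathrm{Ker}(R_\omega)=\{0\}$ such that, for a constant $\Lambda<\infty$ independent of $\omega$, $\|R_\omega\|_{V_\omega\to V}=\sup_{\|v_\omega\|_\omega=1}\|R_\omega v_\omega\|\le\Lambda$ for all $\omega\in\Omega$. The linear operator $T_\omega:V\to V_\omega$ is defined by $a_\omega(T_\omega v,v_\omega)=a(v,R_\omega v_\omega)$ for all $v_\omega\in V_\omega$. Algorithm. Let $\omega_0,\omega_1,\ldots$ be independent samples from $\Omega$, identically distributed according to $\rho$. Set $u^{(0)}=0$ and, for $m=0,1,\ldots$, $$u^{(m+1)}=\alpha_m u^{(m)}+\xi_m R_{\omega_m}r^{(m)}_{\omega_m},\qquad r^{(m)}_{\omega_m}=T_{\omega_m}(u-u^{(m)}),\qquad \alpha_m=1-\frac{1}{m+2},$$ where $\xi_m\in\mathbb{R}$ minimizes $\xi\mapsto\|u-\alpha_m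 u^{(m)}-\xi R_{\omega_m}r^{(m)}_{\omega_m}\|^2$ (if $R_{\omega_m}r^{(m)}_{\omega_m}=0$ the value of $\xi_m$ is irrelevant). Thus $u^{(m)}$ and $\delta_m^2$ are random variables on $\Omega^m$ equipped with the product measure $\rho^m$, and $\mathbb{E}$ denotes expectation with respect to it. The class $A_2$. An element $h\in V$ belongs to $A_2$ if there are $v_\omega\in V_\omega$, $\omega\in\Omega$, such that $\omega\mapsto R_\omega v_\omega\in V$ is Bochner-measurable, the scalar function $\omega\mapsto\|v_\omega\|_\omega$ is measurable, and $$h=\int_\Omega R_\omega v_\omega\,d\rho_\omega\ \text{ (Bochner integral)},\qquad \int_\Omega\|v_\omega\|_\omega^2\,d\rho_\omega<\infty.$$ The norm is $\|h\|_{A_2}:=\inf\left(\int_\Omega\|v_\omega\|_\omega^2\,d\rho_\omega\right)^{1/2}$, the infimum being taken over all such representations of $h$. *)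

theory Defs
  imports "HOL-Probability.Probability"
begin

definition form_norm :: "('a \<Rightarrow> 'a \<Rightarrow> real) \<Rightarrow> 'a \<Rightarrow> real" where
  "form_norm b x = sqrt (b x x)"

definition coercive :: "('a::real_normed_vector \<Rightarrow> 'a \<Rightarrow> real) \<Rightarrow> bool" where
  "coercive b \<longleftrightarrow> (\<exists>c>0. \<forall>x. c * (norm x)\<^sup>2 \<le> b x x)"

definition linear_map_on :: "'a::real_vector set \<Rightarrow> ('a \<Rightarrow> 'b::real_vector) \<Rightarrow> bool" where
  "linear_map_on S f \<longleftrightarrow>
     (\<forall>x\<in>S. \<forall>y\<in>S. f (x + y) = f x + f y) \<and> (\<forall>c. \<forall>x\<in>S. f (c *\<^sub>R x) = c *\<^sub>R f x)"

definition scalar_product_on :: "'a::real_vector set \<Rightarrow> ('a \<Rightarrow> 'a \<Rightarrow> real) \<Rightarrow> bool" where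
  "scalar_product_on S b \<longleftrightarrow>
     (\<forall>y\<in>S. linear_map_on S (\<lambda>x. b x y)) \<and>
     (\<forall>x\<in>S. \<forall>y\<in>S. b x y = b y x) \<and>
     (\<forall>x\<in>S. x \<noteq> 0 \<longrightarrow> 0 < b x x)"

text \<open>
  A family of possibly different Hilbert spaces \<open>V\<^sub>\<omega>\<close> is modelled by linear subspaces
  \<open>S\<close> of one real vector space, each with its own scalar product (whose values
  outside \<open>S\<close> are irrelevant). No topology is imposed on the ambient space, so this is no loss
  of generality: every family of vector spaces embeds into its direct sum.
\<close>

definition separable_hilbert_on :: "'a::real_vector set \<Rightarrow> ('a \<Rightarrow> 'a \<Rightarrow> real) \<Rightarrow> bool" where
  "separable_hilbert_on S b \<longleftrightarrow>
     subspace S \<and> scalar_product_on S b \<and>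
     (\<forall>x. (\<forall>n. x n \<in> S) \<and>
          (\<forall>e>0. \<exists>N. \<forall>m\<ge>N. \<forall>n\<ge>N. form_norm b (x m - x n) < e) \<longrightarrow>
        (\<exists>l\<in>S. (\<lambda>n::nat. form_norm b (x n - l)) \<longlonglongrightarrow> 0)) \<and>
     (\<exists>D. countable D \<and> D \<subseteq> S \<and> (\<forall>x\<in>S. \<forall>e>0. \<exists>d\<in>D. form_norm b (x - d) < e))"

definition spectrally_equivalent_on ::
  "'a set \<Rightarrow> ('a \<Rightarrow> 'a \<Rightarrow> real) \<Rightarrow> ('a \<Rightarrow> 'a \<Rightarrow> real) \<Rightarrow> bool" where
  "spectrally_equivalent_on S b b' \<longleftrightarrow>
     (\<exists>c>0. \<exists>C>0. \<forall>x\<in>S. c * b x x \<le> b' x x \<and> b' x x \<le> C * b x x)"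

text \<open>
  As \<open>V\<close> is separable, Bochner measurability of a \<open>V\<close>-valued map is Borel measurability. The
  Bochner integral, closures and Borel sets of \<open>V\<close> are taken in the topology of the given
  norm; they do not change under passage to the equivalent energy norm.
\<close>

definition A2_representation ::
  "'o measure \<Rightarrow> ('o \<Rightarrow> 'w set) \<Rightarrow> ('o \<Rightarrow> 'w \<Rightarrow> 'w \<Rightarrow> real) \<Rightarrow>
   ('o \<Rightarrow> 'w \<Rightarrow> 'v::{banach, second_countable_topology}) \<Rightarrow> 'v \<Rightarrow> ('o \<Rightarrow> 'w) \<Rightarrow> bool" where
  "A2_representation \<rho> W aw R h v \<longleftrightarrow>
     (\<forall>\<omega>\<in>space \<rho>. v \<omega> \<in> W \<omega>) \<and>
     (\<lambda>\<omega>. R \<omega> (v \<omega>)) \<in> borel_measurable \<rho> \<and>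
     (\<lambda>\<omega>. form_norm (aw \<omega>) (v \<omega>)) \<in> borel_measurable \<rho> \<and>
     has_bochner_integral \<rho> (\<lambda>\<omega>. R \<omega> (v \<omega>)) h \<and>
     integrable \<rho> (\<lambda>\<omega>. (form_norm (aw \<omega>) (v \<omega>))\<^sup>2)"

definition A2 ::
  "'o measure \<Rightarrow> ('o \<Rightarrow> 'w set) \<Rightarrow> ('o \<Rightarrow> 'w \<Rightarrow> 'w \<Rightarrow> real) \<Rightarrow>
   ('o \<Rightarrow> 'w \<Rightarrow> 'v::{banach, second_countable_topology}) \<Rightarrow> 'v set" where
  "A2 \<rho> W aw R = {h. \<exists>v. A2_representation \<rho> W aw R h v}"

definition A2_norm ::
  "'o measure \<Rightarrow> ('o \<Rightarrow> 'w set) \<Rightarrow> ('o \<Rightarrow> 'w \<Rightarrow> 'w \<Rightarrow> real) \<Rightarrow>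
   ('o \<Rightarrow> 'w \<Rightarrow> 'v::{banach, second_countable_topology}) \<Rightarrow> 'v \<Rightarrow> real" where
  "A2_norm \<rho> W aw R h =
     (INF v\<in>{v. A2_representation \<rho> W aw R h v}.
        sqrt (\<integral>\<omega>. (form_norm (aw \<omega>) (v \<omega>))\<^sup>2 \<partial>\<rho>))"

definition relax :: "nat \<Rightarrow> real" where
  "relax m = 1 - 1 / (real m + 2)"

text \<open>
  The \<open>m\<close>-th iterate along the samples \<open>s 0, s 1, \<dots>\<close>; only \<open>s 0, \<dots>, s (m - 1)\<close>
  are sampled from when it is computed. The step sizes \<open>\<xi> m s\<close> are a parameter,
  constrained separately to be minimizers because they are not unique when the search
  direction vanishes.
\<close>

primrec iterate ::
  "('o \<Rightarrow> 'w \<Rightarrow> 'v::real_vector) \<Rightarrow> ('o \<Rightarrow> 'v \<Rightarrow> 'w) \<Rightarrow> 'v \<Rightarrow> (nat \<Rightarrow> (nat \<Rightarrow> 'o) \<Rightarrow> real) \<Rightarrow>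
   nat \<Rightarrow> (nat \<Rightarrow> 'o) \<Rightarrow> 'v" where
  "iterate R T u \<xi> 0 s = 0"
| "iterate R T u \<xi> (Suc m) s =
     relax m *\<^sub>R iterate R T u \<xi> m s
       + \<xi> m s *\<^sub>R R (s m) (T (s m) (u - iterate R T u \<xi> m s))"

definition optimal_steps ::
  "('v::real_vector \<Rightarrow> 'v \<Rightarrow> real) \<Rightarrow> 'o set \<Rightarrow> ('o \<Rightarrow> 'w \<Rightarrow> 'v) \<Rightarrow> ('o \<Rightarrow> 'v \<Rightarrow> 'w) \<Rightarrow> 'v \<Rightarrow>
   (nat \<Rightarrow> (nat \<Rightarrow> 'o) \<Rightarrow> real) \<Rightarrow> bool" where
  "optimal_steps a \<Omega> R T u \<xi> \<longleftrightarrow>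
     (\<forall>m. \<forall>s \<in> {..m} \<rightarrow> \<Omega>.
        is_arg_min
          (\<lambda>t. (form_norm a (u - relax m *\<^sub>R iterate R T u \<xi> m s
                  - t *\<^sub>R R (s m) (T (s m) (u - iterate R T u \<xi> m s))))\<^sup>2)
          (\<lambda>_. True) (\<xi> m s))"

definition sq_error ::
  "('v::real_vector \<Rightarrow> 'v \<Rightarrow> real) \<Rightarrow> ('o \<Rightarrow> 'w \<Rightarrow> 'v) \<Rightarrow> ('o \<Rightarrow> 'v \<Rightarrow> 'w) \<Rightarrow> 'v \<Rightarrow>
   (nat \<Rightarrow> (nat \<Rightarrow> 'o) \<Rightarrow> real) \<Rightarrow> nat \<Rightarrow> (nat \<Rightarrow> 'o) \<Rightarrow> real" where
  "sq_error a R T u \<xi> m s = (form_norm a (u - iterate R T u \<xi> m s))\<^sup>2"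

abbreviation sample_measure :: "'o measure \<Rightarrow> nat \<Rightarrow> (nat \<Rightarrow> 'o) measure" where
  "sample_measure \<rho> m \<equiv> Pi\<^sub>M {..<m} (\<lambda>_. \<rho>)"

end

theory Submission
  imports Defs
begin

text \<open>
  Let \<open>e = u - u\<^sup>m\<close> be the error, \<open>x = \<parallel>u - h\<parallel>\<close>, \<open>\<alpha> = (m + 1) / (m + 2)\<close>, and let \<open>\<psi>\<close> be the
  correction \<open>R\<^sub>\<omega> T\<^sub>\<omega> e\<close>, normalised. A step replaces the error by the distance of
  \<open>\<alpha> e + (1 - \<alpha>) u\<close> to the line spanned by \<open>\<psi>\<close>, so the new error is at most the distance to any
  convenient point of that line. Given a representation \<open>h = \<integral> R\<^sub>\<omega> v\<^sub>\<omega>\<close>, the point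
  \<open>(1 - \<alpha>) \<tau> \<psi>\<close> with \<open>\<tau> = \<Lambda> \<parallel>v\<^sub>\<omega>\<parallel>\<close> is a good choice: since
  \<open>a e \<psi> = \<parallel>T\<^sub>\<omega> e\<parallel>\<^sup>2 / \<parallel>R\<^sub>\<omega> T\<^sub>\<omega> e\<parallel> \<ge> \<parallel>T\<^sub>\<omega> e\<parallel> / \<Lambda>\<close>, the Cauchy-Schwarz inequality in
  \<open>V\<^sub>\<omega>\<close> gives \<open>\<tau> * a e \<psi> \<ge> a e (R\<^sub>\<omega> v\<^sub>\<omega>)\<close> (\<open>correlation_bound\<close>), and the right-hand side has
  average \<open>a e h\<close> over \<open>\<omega>\<close> (\<open>expected_step_bound\<close>). Let \<open>D m\<close> be the expected squared error and
  \<open>H\<^sup>2 = \<integral> \<parallel>v\<^sub>\<omega>\<parallel>\<^sup>2\<close>. With the Cauchy-Schwarz inequality for the expectation this becomes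
  \<open>D (m + 1) \<le> (\<alpha> \<surd>(D m) + (1 - \<alpha>) x)\<^sup>2 + (1 - \<alpha>)\<^sup>2 (2 x B + B\<^sup>2)\<close>, where \<open>B = \<Lambda> H + \<parallel>h\<parallel>\<close>
  (\<open>expected_sq_error_recursion\<close>). For \<open>Y m = (m + 1) \<surd>(D m)\<close> it says
  \<open>(Y (m + 1))\<^sup>2 \<le> (Y m + x)\<^sup>2 + 2 x B + B\<^sup>2\<close>, so \<open>Y\<close> grows like \<open>m x\<close> plus a term of order \<open>\<surd>m\<close>,
  which is the claimed rate (\<open>relaxed_recursion_rate\<close>). The infimum over the representations
  of \<open>h\<close> then replaces \<open>H\<close> by the norm of \<open>h\<close> in \<open>A\<^sub>2\<close>.

  The expectations make sense only if the iterates are measurable in the samples. The hypothesis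
  gives measurability of \<open>\<psi>\<close> in \<open>\<omega>\<close> for each fixed \<open>e\<close>, whereas the algorithm inserts a
  random \<open>e\<close>. The operators \<open>K\<^sub>\<omega> = R\<^sub>\<omega> T\<^sub>\<omega>\<close> themselves may fail to be measurable in \<open>\<omega>\<close>, because
  \<open>\<psi>\<close> forgets their scale, and \<open>\<psi>\<close> may be discontinuous in \<open>e\<close> on the kernel of
  \<open>K\<^sub>\<omega>\<close>. But \<open>K\<^sub>\<omega>\<close> is symmetric, so \<open>K\<^sub>\<omega> e = 0\<close> just says that \<open>e\<close> is orthogonal
  to the values of \<open>\<psi>\<close> at a countable dense set of vectors. Hence the kernels form a jointly
  measurable set, and off this set \<open>\<psi>\<close> is continuous in \<open>e\<close>, hence a limit of functions in which
  only finitely many values of \<open>e\<close> occur (\<open>direction_jointly_measurable\<close>).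
\<close>

section \<open>Scalar products and their norms\<close>

lemma form_norm_nonneg:
  "0 \<le> b x x \<Longrightarrow> 0 \<le> form_norm b x"
  by (simp add: form_norm_def)

lemma form_norm_square:
  "0 \<le> b x x \<Longrightarrow> (form_norm b x)\<^sup>2 = b x x"
  by (simp add: form_norm_def)

locale scalar_product_space =
  fixes S :: "'a::real_vector set" and b :: "'a \<Rightarrow> 'a \<Rightarrow> real"
  assumes subspace: "subspace S" and scalar_product: "scalar_product_on S b"
begin

lemma add_left: "x \<in> S \<Longrightarrow> x' \<in> S \<Longrightarrow> y \<in> S \<Longrightarrow> b (x + x') y = b x y + b x' y"
  and scale_left: "x \<in> S \<Longrightarrow> y \<in> S \<Longrightarrow> b (c *\<^sub>R x) y = c * b x y"
  and commute: "x \<in> S \<Longrightarrow> y \<in> S \<Longrightarrow> b x y = b y x"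
  and positive: "x \<in> S \<Longrightarrow> x \<noteq> 0 \<Longrightarrow> 0 < b x x"
  using scalar_product unfolding scalar_product_on_def linear_map_on_def by auto

lemma zero_left: "y \<in> S \<Longrightarrow> b 0 y = 0"
  using scale_left[of y y 0] by simp

lemma nonneg: "x \<in> S \<Longrightarrow> 0 \<le> b x x"
  using positive[of x] zero_left[of 0] by (cases "x = 0") auto

lemma norm_nonneg: "x \<in> S \<Longrightarrow> 0 \<le> form_norm b x"
  by (simp add: form_norm_nonneg nonneg)

lemma norm_square: "x \<in> S \<Longrightarrow> (form_norm b x)\<^sup>2 = b x x"
  by (simp add: form_norm_square nonneg)

lemma norm_eq_0: "x \<in> S \<Longrightarrow> form_norm b x = 0 \<longleftrightarrow> x = 0"
  using positive[of x] zero_left[of x] by (cases "x = 0") (auto simp: form_norm_def)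

lemma diff_left: "x \<in> S \<Longrightarrow> x' \<in> S \<Longrightarrow> y \<in> S \<Longrightarrow> b (x - x') y = b x y - b x' y"
proof -
  assume mem: "x \<in> S" "x' \<in> S" "y \<in> S"
  have "b (x - x' + x') y = b (x - x') y + b x' y"
    by (intro add_left subspace_diff[OF subspace] mem)
  then show ?thesis by simp
qed

lemma norm_scale: "x \<in> S \<Longrightarrow> form_norm b (c *\<^sub>R x) = \<bar>c\<bar> * form_norm b x"
proof -
  assume x: "x \<in> S"
  then have "b (c *\<^sub>R x) (c *\<^sub>R x) = c\<^sup>2 * b x x"
    using subspace_scale[OF subspace x, of c] commute[OF x, of "c *\<^sub>R x"]
    by (simp add: scale_left power2_eq_square)
  then show ?thesis
    by (simp add: form_norm_def real_sqrt_mult)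
qed

lemma Cauchy_Schwarz:
  assumes "x \<in> S" "y \<in> S"
  shows "b x y \<le> form_norm b x * form_norm b y"
proof (cases "x = 0 \<or> y = 0")
  case True
  then show ?thesis
    using assms zero_left[of y] zero_left[of x] commute[of x y]
    by (auto simp: norm_nonneg)
next
  case False
  let ?p = "form_norm b x" and ?q = "form_norm b y"
  have pq: "0 < ?p" "0 < ?q"
    using False assms norm_nonneg[of x] norm_nonneg[of y] norm_eq_0[of x] norm_eq_0[of y] by auto
  define z where "z = ?q *\<^sub>R x - ?p *\<^sub>R y"
  have mem: "?q *\<^sub>R x \<in> S" "?p *\<^sub>R y \<in> S" "z \<in> S"
    using assms subspace by (auto simp: z_def subspace_scale subspace_diff)
  have "b z z = ?q * b z x - ?p * b z y"
    using mem assms commute[of z x] commute[of z y] commute[of "?q *\<^sub>R x" z] commute[of "?p *\<^sub>R y" z]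
    by (subst z_def) (simp add: diff_left scale_left)
  also have "\<dots> = ?q * (?q * b x x - ?p * b x y) - ?p * (?q * b x y - ?p * b y y)"
    using mem assms commute[of y x] by (simp add: z_def diff_left scale_left)
  also have "\<dots> = 2 * (?p * ?q) * (?p * ?q - b x y)"
    by (simp add: algebra_simps power2_eq_square flip: norm_square[OF assms(1)] norm_square[OF assms(2)])
  finally have "0 \<le> 2 * (?p * ?q) * (?p * ?q - b x y)"
    using nonneg[OF mem(3)] by simp
  then show ?thesis
    using zero_le_mult_iff[of "2 * (?p * ?q)" "?p * ?q - b x y"] mult_pos_pos[OF pq] by auto
qed

end

locale energy_form = form: bounded_bilinear a
  for a :: "'v::{real_inner, banach, second_countable_topology} \<Rightarrow> 'v \<Rightarrow> real" +
  assumes symmetric: "a x y = a y x" and coercive: "coercive a"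
begin

lemma coercivity_constant:
  obtains c where "0 < c" "\<And>x. c * (norm x)\<^sup>2 \<le> a x x"
  using coercive unfolding coercive_def by blast

sublocale scalar_product_space UNIV a
proof
  show "scalar_product_on UNIV a"
    unfolding scalar_product_on_def linear_map_on_def
  proof (intro conjI ballI allI impI)
    fix x :: 'v assume "x \<noteq> 0"
    obtain c where "0 < c" "c * (norm x)\<^sup>2 \<le> a x x" using coercivity_constant by metis
    moreover have "0 < c * (norm x)\<^sup>2" using \<open>0 < c\<close> \<open>x \<noteq> 0\<close> by simp
    ultimately show "0 < a x x" by linarith
  qed (simp_all add: form.add_left form.scaleR_left, rule symmetric)
qed simp

lemma norm_triangle: "form_norm a (x + y) \<le> form_norm a x + form_norm a y"
proof (rule power2_le_imp_le)
  have "(form_norm a (x + y))\<^sup>2 = a x x + 2 * a x y + a y y"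
    by (simp add: norm_square form.add_left form.add_right symmetric[of y x])
  also have "\<dots> \<le> (form_norm a x + form_norm a y)\<^sup>2"
    using Cauchy_Schwarz[of x y] by (simp add: power2_sum norm_square)
  finally show "(form_norm a (x + y))\<^sup>2 \<le> \<dots>" .
qed (simp add: norm_nonneg)

lemma square_norm_diff_scale:
  "(form_norm a (w - t *\<^sub>R p))\<^sup>2 = (form_norm a w)\<^sup>2 - 2 * t * a w p + t\<^sup>2 * a p p"
proof -
  have "(form_norm a (w - t *\<^sub>R p))\<^sup>2 = a w w - 2 * t * a w p + t * (t * a p p)"
    by (simp add: norm_square form.diff_left form.diff_right form.scaleR_left form.scaleR_right
        symmetric[of p w] algebra_simps)
  then show ?thesis by (simp add: norm_square[of w] power2_eq_square[of t])
qed

lemma norm_bound: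
  obtains C where "0 < C" "\<And>x. form_norm a x \<le> C * norm x"
proof -
  obtain K where "0 < K" and K: "\<And>x y. norm (a x y) \<le> norm x * norm y * K"
    using form.pos_bounded by blast
  have "form_norm a x \<le> sqrt K * norm x" for x
    unfolding form_norm_def using K[of x x] \<open>0 < K\<close>
    by (intro real_le_lsqrt) (auto simp: power_mult_distrib algebra_simps power2_eq_square[of "norm x"])
  with \<open>0 < K\<close> that[of "sqrt K"] show ?thesis by simp
qed

lemma tendsto_of_norm_le:
  assumes "\<And>n. form_norm a (f n - l) \<le> C * g n" and "g \<longlonglongrightarrow> 0"
  shows "f \<longlonglongrightarrow> l"
proof -
  obtain c where c: "0 < c" "\<And>x. c * (norm x)\<^sup>2 \<le> a x x" by (rule coercivity_constant) blast
  have le: "norm x \<le> form_norm a x / sqrt c" for x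
  proof (rule power2_le_imp_le)
    show "(norm x)\<^sup>2 \<le> (form_norm a x / sqrt c)\<^sup>2"
      using c(2)[of x] \<open>0 < c\<close> by (simp add: power_divide norm_square field_simps)
  qed (use c(1) in \<open>simp add: norm_nonneg\<close>)
  have "norm (f n - l) \<le> C / sqrt c * g n" for n
  proof -
    have "norm (f n - l) \<le> form_norm a (f n - l) / sqrt c" by (rule le)
    also have "\<dots> \<le> C * g n / sqrt c"
      using c(1) by (intro divide_right_mono assms(1)) simp
    finally show ?thesis by simp
  qed
  then have "\<forall>\<^sub>F n in sequentially. norm (f n - l) \<le> C / sqrt c * g n"
    by (rule always_eventually[OF allI])
  moreover have "(\<lambda>n. C / sqrt c * g n) \<longlonglongrightarrow> 0"
    by (rule tendsto_mult_right_zero[OF assms(2)])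
  ultimately have "(\<lambda>n. f n - l) \<longlonglongrightarrow> 0"
    by (rule Lim_null_comparison)
  then show ?thesis by (rule LIM_zero_cancel)
qed

lemma continuous_form: "continuous_on UNIV (\<lambda>z. a (fst z) (snd z))"
  by (intro form.continuous_on continuous_intros)

lemma measurable_form [measurable (raw)]:
  "f \<in> borel_measurable M \<Longrightarrow> g \<in> borel_measurable M \<Longrightarrow> (\<lambda>z. a (f z) (g z)) \<in> borel_measurable M"
  by (rule borel_measurable_continuous_Pair[OF _ _ continuous_form])

lemma eq_0_of_orthogonal_dense:
  assumes dense: "\<And>X. open X \<Longrightarrow> X \<noteq> {} \<Longrightarrow> \<exists>d\<in>D. d \<in> X"
    and orth: "\<And>d. d \<in> D \<Longrightarrow> a y d = 0"
  shows "y = 0"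
proof (rule ccontr)
  assume "y \<noteq> 0"
  have "open {x. a y x \<noteq> 0}"
    by (intro open_Collect_neq continuous_intros form.continuous_on)
  moreover have "y \<in> {x. a y x \<noteq> 0}"
    using positive[of y] \<open>y \<noteq> 0\<close> by simp
  ultimately show False using dense orth by blast
qed

end


section \<open>The rate of the relaxed recursion\<close>

lemma relax_less_1: "relax m < 1" and relax_nonneg: "0 \<le> relax m"
  by (simp_all add: relax_def)

text \<open>
  The induction is on \<open>Y m = (m + 1) * sqrt (D m)\<close>: multiplied by \<open>(m + 2)\<^sup>2\<close>, the hypothesis reads
  \<open>(Y (m + 1))\<^sup>2 \<le> (Y m + x)\<^sup>2 + 2 * x * B + B\<^sup>2\<close>, and \<open>2 * (n * x + C * sqrt n)\<close> with \<open>n = m + 1\<close>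
  is a supersolution. The factor 2 leaves room for the mixed term \<open>2 * x * B\<close>.
\<close>

lemma relaxed_recursion_rate:
  fixes D :: "nat \<Rightarrow> real"
  assumes D_nonneg: "\<And>m. 0 \<le> D m" and start: "D 0 \<le> C\<^sup>2"
    and step: "\<And>m. D (Suc m) \<le> (relax m * sqrt (D m) + (1 - relax m) * x)\<^sup>2
                               + (1 - relax m)\<^sup>2 * (2 * x * B + B\<^sup>2)"
    and nonneg: "0 \<le> x" "0 \<le> B" and BC: "B \<le> C"
  shows "sqrt (D m) \<le> 2 * (x + C / sqrt (real m + 1))"
proof -
  have C: "0 \<le> C" using nonneg BC by linarith
  have main: "(real m + 1) * sqrt (D m) \<le> 2 * ((real m + 1) * x + C * sqrt (real m + 1))" for m
  proof (induction m)
    case 0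
    have "sqrt (D 0) \<le> C" using start C by (simp add: real_le_lsqrt)
    then show ?case using nonneg C by simp
  next
    case (Suc m)
    define n where "n = real m + 1"
    define Y where "Y = n * sqrt (D m)"
    define q r where "q = sqrt n" and "r = sqrt (n + 1)"
    have n: "1 \<le> n" and q: "q\<^sup>2 = n" "1 \<le> q" and r: "r\<^sup>2 = n + 1" "q \<le> r"
      by (auto simp: n_def q_def r_def)
    have Y: "0 \<le> Y" "Y \<le> 2 * (n * x + C * q)"
      using Suc n D_nonneg by (auto simp: Y_def n_def q_def)
    have al: "(n + 1) * relax m = n" "(n + 1) * (1 - relax m) = 1"
      by (auto simp: relax_def n_def field_simps)
    have sq: "(n + 1)\<^sup>2 * ((relax m * sqrt (D m) + (1 - relax m) * x)\<^sup>2 + (1 - relax m)\<^sup>2 * E)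
      = (((n + 1) * relax m) * sqrt (D m) + ((n + 1) * (1 - relax m)) * x)\<^sup>2
         + ((n + 1) * (1 - relax m))\<^sup>2 * E" for E
      by (simp add: power2_eq_square algebra_simps)
    have "((n + 1) * sqrt (D (Suc m)))\<^sup>2 = (n + 1)\<^sup>2 * D (Suc m)"
      using D_nonneg by (simp add: power_mult_distrib)
    also have "\<dots> \<le> (Y + x)\<^sup>2 + (2 * x * B + B\<^sup>2)"
      using mult_left_mono[OF step[of m], of "(n + 1)\<^sup>2"] unfolding sq al by (simp add: Y_def)
    also have "\<dots> \<le> (2 * (n * x + C * q) + x)\<^sup>2 + (2 * x * B + B\<^sup>2)"
      using Y nonneg by (intro add_right_mono power_mono) auto
    also have "\<dots> \<le> (2 * (n * x + C * q) + x)\<^sup>2 + (2 * x * C + C\<^sup>2)"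
      using mult_left_mono[OF BC, of x] power_mono[OF BC, of 2] nonneg by simp
    also have "\<dots> \<le> (2 * (n * x + C * q) + x)\<^sup>2 + ((4 * n + 3) * x\<^sup>2 + 4 * q * (x * C) + 4 * C\<^sup>2)"
    proof -
      have "x * C \<le> q * (x * C)" using q nonneg C mult_right_mono[of 1 q "x * C"] by simp
      moreover have "0 \<le> x * C" "0 \<le> (4 * n + 3) * x\<^sup>2" using n nonneg C by auto
      moreover have "0 \<le> C\<^sup>2" by simp
      ultimately show ?thesis by linarith
    qed
    also have "\<dots> = (2 * (n + 1) * x)\<^sup>2 + 8 * (n + 1) * (x * C) * q + 4 * C\<^sup>2 * (n + 1)"
      unfolding q(1)[symmetric] by (simp add: power2_eq_square algebra_simps)
    also have "\<dots> \<le> (2 * (n + 1) * x)\<^sup>2 + 8 * (n + 1) * (x * C) * r + 4 * C\<^sup>2 * (n + 1)"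
      using r n nonneg C by (intro add_mono mult_left_mono) auto
    also have "\<dots> = (2 * ((n + 1) * x + C * r))\<^sup>2"
    proof -
      have "(2 * ((n + 1) * x + C * r))\<^sup>2
        = (2 * (n + 1) * x)\<^sup>2 + 8 * (n + 1) * (x * C) * r + 4 * C\<^sup>2 * r\<^sup>2"
        by (simp add: power2_eq_square algebra_simps)
      then show ?thesis unfolding r(1) by simp
    qed
    finally have "(n + 1) * sqrt (D (Suc m)) \<le> 2 * ((n + 1) * x + C * r)"
      by (rule power2_le_imp_le) (use n nonneg C q r in simp)
    moreover have "real (Suc m) + 1 = n + 1" by (simp add: n_def)
    ultimately show ?case by (simp only: r_def)
  qed
  let ?q = "sqrt (real m + 1)"
  have "(real m + 1) * (2 * (x + C / ?q)) = 2 * ((real m + 1) * x + C * (?q * ?q / ?q))"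
    by (simp add: algebra_simps)
  also have "?q * ?q / ?q = ?q" by (rule nonzero_mult_div_cancel_right) simp
  finally have "(real m + 1) * sqrt (D m) \<le> (real m + 1) * (2 * (x + C / ?q))"
    using main[of m] by simp
  then show ?thesis by (rule mult_left_le_imp_le) simp
qed


section \<open>Random subspace corrections\<close>

locale random_subspaces =
  energy_form a + prob_space \<rho>
  for a :: "'v::{real_inner, banach, second_countable_topology} \<Rightarrow> 'v \<Rightarrow> real"
    and \<rho> :: "'o measure" +
  fixes W :: "'o \<Rightarrow> 'w::real_vector set" and aw :: "'o \<Rightarrow> 'w \<Rightarrow> 'w \<Rightarrow> real"
    and R :: "'o \<Rightarrow> 'w \<Rightarrow> 'v" and T :: "'o \<Rightarrow> 'v \<Rightarrow> 'w" and \<Lambda> :: real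
  assumes W_space: "\<omega> \<in> space \<rho> \<Longrightarrow> scalar_product_space (W \<omega>) (aw \<omega>)"
    and R_linear: "\<omega> \<in> space \<rho> \<Longrightarrow> linear_map_on (W \<omega>) (R \<omega>)"
    and R_kernel: "\<omega> \<in> space \<rho> \<Longrightarrow> {w \<in> W \<omega>. R \<omega> w = 0} = {0}"
    and R_unit_bound: "\<omega> \<in> space \<rho> \<Longrightarrow> w \<in> W \<omega> \<Longrightarrow> form_norm (aw \<omega>) w = 1 \<Longrightarrow>
                    form_norm a (R \<omega> w) \<le> \<Lambda>"
    and T_range: "\<omega> \<in> space \<rho> \<Longrightarrow> T \<omega> v \<in> W \<omega>"
    and T_adjoint: "\<omega> \<in> space \<rho> \<Longrightarrow> w \<in> W \<omega> \<Longrightarrow> aw \<omega> (T \<omega> v) w = a v (R \<omega> w)"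
begin

definition direction :: "'o \<Rightarrow> 'v \<Rightarrow> 'v" where
  "direction \<omega> e = (if R \<omega> (T \<omega> e) \<noteq> 0
     then R \<omega> (T \<omega> e) /\<^sub>R form_norm a (R \<omega> (T \<omega> e)) else 0)"

lemma R_diff:
  assumes "\<omega> \<in> space \<rho>" "w \<in> W \<omega>" "w' \<in> W \<omega>"
  shows "R \<omega> (w - w') = R \<omega> w - R \<omega> w'"
proof -
  interpret scalar_product_space "W \<omega>" "aw \<omega>" by (rule W_space[OF assms(1)])
  have "R \<omega> (w - w' + w') = R \<omega> (w - w') + R \<omega> w'"
    using R_linear[OF assms(1)] subspace_diff[OF subspace assms(2,3)] assms(3)
    unfolding linear_map_on_def by blast
  then show ?thesis by simp
qed

lemma R_eq_0_iff:
  "\<omega> \<in> space \<rho> \<Longrightarrow> w \<in> W \<omega> \<Longrightarrow> R \<omega> w = 0 \<longleftrightarrow> w = 0"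
  using R_kernel[of \<omega>] by auto

lemma R_bound:
  assumes \<omega>: "\<omega> \<in> space \<rho>" and w: "w \<in> W \<omega>"
  shows "form_norm a (R \<omega> w) \<le> \<Lambda> * form_norm (aw \<omega>) w"
proof -
  interpret W: scalar_product_space "W \<omega>" "aw \<omega>" by (rule W_space[OF \<omega>])
  show ?thesis
  proof (cases "w = 0")
    case True
    then show ?thesis
      using R_eq_0_iff[OF \<omega> w] norm_eq_0[of 0] W.norm_eq_0[OF w] by simp
  next
    case False
    define s where "s = form_norm (aw \<omega>) w"
    have s: "0 < s" using W.norm_nonneg[OF w] W.norm_eq_0[OF w] False by (simp add: s_def)
    have mem: "inverse s *\<^sub>R w \<in> W \<omega>" using w by (rule subspace_scale[OF W.subspace])
    have "form_norm (aw \<omega>) (inverse s *\<^sub>R w) = 1"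
      using s by (simp add: W.norm_scale[OF w] flip: s_def)
    then have "form_norm a (R \<omega> (inverse s *\<^sub>R w)) \<le> \<Lambda>" by (rule R_unit_bound[OF \<omega> mem])
    moreover have "R \<omega> (inverse s *\<^sub>R w) = inverse s *\<^sub>R R \<omega> w"
      using R_linear[OF \<omega>] w unfolding linear_map_on_def by blast
    ultimately have "inverse s * form_norm a (R \<omega> w) \<le> \<Lambda>"
      using s by (simp add: norm_scale)
    then show ?thesis using s by (simp add: field_simps flip: s_def)
  qed
qed

lemma \<Lambda>_norm_nonneg:
  "\<omega> \<in> space \<rho> \<Longrightarrow> w \<in> W \<omega> \<Longrightarrow> 0 \<le> \<Lambda> * form_norm (aw \<omega>) w"
  by (rule order_trans[OF norm_nonneg R_bound]) simp

text \<open>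
  A negative \<open>\<Lambda>\<close> forces all the spaces \<open>W \<omega>\<close> to be trivial, so it may be replaced by its absolute value.
\<close>

lemma \<Lambda>_norm_abs:
  assumes "\<omega> \<in> space \<rho>" "w \<in> W \<omega>"
  shows "\<Lambda> * form_norm (aw \<omega>) w = \<bar>\<Lambda>\<bar> * form_norm (aw \<omega>) w"
proof -
  interpret W: scalar_product_space "W \<omega>" "aw \<omega>" by (rule W_space[OF assms(1)])
  show ?thesis
    using abs_of_nonneg[OF \<Lambda>_norm_nonneg[OF assms]] W.norm_nonneg[OF assms(2)]
    by (auto simp: abs_mult)
qed

lemma correction_symmetric:
  assumes \<omega>: "\<omega> \<in> space \<rho>"
  shows "a (R \<omega> (T \<omega> e)) d = a e (R \<omega> (T \<omega> d))"
proof -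
  interpret W: scalar_product_space "W \<omega>" "aw \<omega>" by (rule W_space[OF \<omega>])
  have "a d (R \<omega> (T \<omega> e)) = aw \<omega> (T \<omega> d) (T \<omega> e)" by (simp add: T_adjoint T_range \<omega>)
  also have "\<dots> = aw \<omega> (T \<omega> e) (T \<omega> d)" by (intro W.commute T_range \<omega>)
  also have "\<dots> = a e (R \<omega> (T \<omega> d))" by (simp add: T_adjoint T_range \<omega>)
  finally show ?thesis by (simp only: symmetric[of d])
qed

text \<open>
  Testing the defining equation of \<open>T \<omega> e - T \<omega> e'\<close> with this vector itself bounds \<open>T \<omega>\<close> by the norm of
  \<open>R \<omega>\<close>.
\<close>

lemma correction_Lipschitz:
  assumes \<omega>: "\<omega> \<in> space \<rho>"
  shows "form_norm a (R \<omega> (T \<omega> e) - R \<omega> (T \<omega> e')) \<le> \<Lambda>\<^sup>2 * form_norm a (e - e')"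
proof -
  interpret W: scalar_product_space "W \<omega>" "aw \<omega>" by (rule W_space[OF \<omega>])
  define w where "w = T \<omega> e - T \<omega> e'"
  have w: "w \<in> W \<omega>" unfolding w_def by (intro subspace_diff[OF W.subspace] T_range \<omega>)
  let ?s = "form_norm (aw \<omega>) w"
  have "?s * ?s = a (e - e') (R \<omega> w)"
    using W.norm_square[OF w] W.diff_left[OF T_range[OF \<omega>] T_range[OF \<omega>] w, of e e']
    by (simp add: power2_eq_square T_adjoint \<omega> w form.diff_left flip: w_def)
  also have "\<dots> \<le> form_norm a (e - e') * form_norm a (R \<omega> w)"
    by (rule Cauchy_Schwarz) auto
  also have "\<dots> \<le> form_norm a (e - e') * (\<bar>\<Lambda>\<bar> * ?s)"
    using R_bound[OF \<omega> w] \<Lambda>_norm_abs[OF \<omega> w] by (intro mult_left_mono norm_nonneg) auto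
  finally have "?s \<le> \<bar>\<Lambda>\<bar> * form_norm a (e - e')"
    using W.norm_nonneg[OF w] norm_nonneg[of "e - e'"]
    by (cases "?s = 0") (auto simp: mult.commute mult.left_commute)
  then have "\<bar>\<Lambda>\<bar> * ?s \<le> \<bar>\<Lambda>\<bar> * (\<bar>\<Lambda>\<bar> * form_norm a (e - e'))"
    by (rule mult_left_mono) simp
  moreover have "form_norm a (R \<omega> w) \<le> \<bar>\<Lambda>\<bar> * ?s"
    using R_bound[OF \<omega> w] \<Lambda>_norm_abs[OF \<omega> w] by simp
  moreover have "R \<omega> w = R \<omega> (T \<omega> e) - R \<omega> (T \<omega> e')"
    unfolding w_def by (intro R_diff T_range \<omega>)
  ultimately show ?thesis by (simp add: power2_eq_square flip: mult.assoc)
qed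

lemma correction_tendsto:
  assumes \<omega>: "\<omega> \<in> space \<rho>" and "f \<longlonglongrightarrow> e"
  shows "(\<lambda>n. R \<omega> (T \<omega> (f n))) \<longlonglongrightarrow> R \<omega> (T \<omega> e)"
proof -
  obtain C where C: "\<And>x. form_norm a x \<le> C * norm x" using norm_bound by metis
  have "form_norm a (R \<omega> (T \<omega> (f n)) - R \<omega> (T \<omega> e)) \<le> \<Lambda>\<^sup>2 * C * norm (f n - e)" for n
    using order_trans[OF correction_Lipschitz[OF \<omega>] mult_left_mono[OF C, of "\<Lambda>\<^sup>2"]]
    by (simp add: mult.assoc)
  moreover have "(\<lambda>n. norm (f n - e)) \<longlonglongrightarrow> 0"
    using assms(2) by (simp add: LIM_zero_iff tendsto_norm_zero)
  ultimately show ?thesis by (rule tendsto_of_norm_le)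
qed

lemma direction_tendsto:
  assumes \<omega>: "\<omega> \<in> space \<rho>" and f: "f \<longlonglongrightarrow> e" and nz: "R \<omega> (T \<omega> e) \<noteq> 0"
  shows "(\<lambda>n. direction \<omega> (f n)) \<longlonglongrightarrow> direction \<omega> e"
proof -
  let ?K = "\<lambda>e. R \<omega> (T \<omega> e)"
  have K: "(\<lambda>n. ?K (f n)) \<longlonglongrightarrow> ?K e" by (rule correction_tendsto[OF \<omega> f])
  have "(\<lambda>n. form_norm a (?K (f n))) \<longlonglongrightarrow> form_norm a (?K e)"
    unfolding form_norm_def by (intro tendsto_real_sqrt form.tendsto K)
  moreover have "form_norm a (?K e) \<noteq> 0" using nz norm_eq_0 by simp
  ultimately have "(\<lambda>n. ?K (f n) /\<^sub>R form_norm a (?K (f n))) \<longlonglongrightarrow> ?K e /\<^sub>R form_norm a (?K e)"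
    by (intro tendsto_intros K)
  moreover have "(\<lambda>n. direction \<omega> (f n)) = (\<lambda>n. ?K (f n) /\<^sub>R form_norm a (?K (f n)))"
    by (auto simp: direction_def)
  ultimately show ?thesis using nz by (simp add: direction_def)
qed

lemma direction_normalised: "a (direction \<omega> e) (direction \<omega> e) = (if direction \<omega> e = 0 then 0 else 1)"
proof (cases "R \<omega> (T \<omega> e) = 0")
  case False
  then have "form_norm a (R \<omega> (T \<omega> e)) \<noteq> 0" using norm_eq_0 by simp
  with False show ?thesis
    using norm_square[of "R \<omega> (T \<omega> e)"] positive[of "R \<omega> (T \<omega> e)"]
    by (simp add: direction_def form.scaleR_left form.scaleR_right power2_eq_square field_simps)
qed (simp add: direction_def form.zero_left)

lemma orthogonal_direction_iff:
  "a e (direction \<omega> d) = 0 \<longleftrightarrow> a e (R \<omega> (T \<omega> d)) = 0"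
  using norm_eq_0[of "R \<omega> (T \<omega> d)"]
  by (auto simp: direction_def form.scaleR_right form.zero_right)

text \<open>
  For \<open>\<tau> = \<Lambda> * form_norm (aw \<omega>) w\<close>, the point \<open>\<tau> *\<^sub>R direction \<omega> e\<close> is at least as well correlated
  with the error \<open>e\<close> as \<open>R \<omega> w\<close>, although it does not see \<open>w\<close> except through its norm.
\<close>

lemma correlation_bound:
  assumes \<omega>: "\<omega> \<in> space \<rho>" and w: "w \<in> W \<omega>"
  shows "a e (R \<omega> w) \<le> \<Lambda> * form_norm (aw \<omega>) w * a e (direction \<omega> e)"
proof -
  interpret W: scalar_product_space "W \<omega>" "aw \<omega>" by (rule W_space[OF \<omega>])
  define t where "t = T \<omega> e"
  have t: "t \<in> W \<omega>" unfolding t_def by (rule T_range[OF \<omega>])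
  let ?s = "form_norm (aw \<omega>) t" and ?k = "form_norm a (R \<omega> t)" and ?n = "form_norm (aw \<omega>) w"
  have ew: "a e (R \<omega> w) = aw \<omega> t w" unfolding t_def by (rule T_adjoint[OF \<omega> w, symmetric])
  show ?thesis
  proof (cases "R \<omega> t = 0")
    case True
    then have "t = 0" using R_eq_0_iff[OF \<omega> t] by simp
    then show ?thesis
      using True W.zero_left[OF w] by (simp add: ew direction_def form.zero_right flip: t_def)
  next
    case False
    have k: "0 < ?k" using False norm_nonneg[of "R \<omega> t"] norm_eq_0[of "R \<omega> t"] by simp
    have corr: "a e (direction \<omega> e) = ?s\<^sup>2 / ?k"
      using False T_adjoint[OF \<omega> t, of e] W.norm_square[OF t]
      by (simp add: direction_def form.scaleR_right field_simps flip: t_def)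
    have "?k * (?s * ?n) \<le> (\<Lambda> * ?s) * (?s * ?n)"
      by (intro mult_right_mono R_bound[OF \<omega> t] mult_nonneg_nonneg W.norm_nonneg t w)
    then have "?s * ?n \<le> \<Lambda> * ?n * (?s\<^sup>2 / ?k)"
      using k by (simp add: field_simps power2_eq_square)
    with W.Cauchy_Schwarz[OF t w] show ?thesis unfolding ew corr by linarith
  qed
qed

text \<open>
  The algorithm with its minimisation solved: the best approximation of \<open>w\<close> by multiples of a unit vector
  \<open>p\<close> is \<open>a w p *\<^sub>R p\<close>. A step size is arbitrary where the correction vanishes, and there it may even
  depend on samples not yet drawn; the product of step size and correction is free of this ambiguity,
  and is a measurable function of the samples drawn so far.
\<close>

primrec projected_iterate :: "'v \<Rightarrow> nat \<Rightarrow> (nat \<Rightarrow> 'o) \<Rightarrow> 'v" where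
  "projected_iterate u 0 s = 0"
| "projected_iterate u (Suc m) s =
     relax m *\<^sub>R projected_iterate u m s
       + a (u - relax m *\<^sub>R projected_iterate u m s) (direction (s m) (u - projected_iterate u m s))
         *\<^sub>R direction (s m) (u - projected_iterate u m s)"

lemma minimal_multiple:
  assumes "is_arg_min (\<lambda>t. (form_norm a (w - t *\<^sub>R k))\<^sup>2) (\<lambda>_. True) \<xi>"
  shows "\<xi> * a k k = a w k"
proof (cases "k = 0")
  case False
  have k: "0 < a k k" using False positive by simp
  define t where "t = a w k / a k k"
  have "(form_norm a (w - \<xi> *\<^sub>R k))\<^sup>2 \<le> (form_norm a (w - t *\<^sub>R k))\<^sup>2"
    using assms unfolding is_arg_min_def by (meson not_le)
  moreover have "a w k = t * a k k" using k by (simp add: t_def)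
  ultimately have "(\<xi> - t)\<^sup>2 * a k k \<le> 0"
    unfolding square_norm_diff_scale by (simp add: power2_eq_square algebra_simps)
  then have "\<xi> = t" using k by (simp add: mult_le_0_iff)
  then show ?thesis using k by (simp add: t_def)
qed (simp add: form.zero_right)

lemma iterate_eq_projected_iterate:
  assumes steps: "optimal_steps a (space \<rho>) R T u \<xi>"
  shows "s \<in> {..<m} \<rightarrow> space \<rho> \<Longrightarrow> iterate R T u \<xi> m s = projected_iterate u m s"
proof (induction m)
  case (Suc m)
  define x where "x = projected_iterate u m s"
  have x: "iterate R T u \<xi> m s = x"
    using Suc by (auto simp: x_def Pi_iff)
  define w where "w = u - relax m *\<^sub>R x"
  define k where "k = R (s m) (T (s m) (u - x))"
  have "s \<in> {..m} \<rightarrow> space \<rho>" using Suc.prems by (simp add: lessThan_Suc_atMost)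
  then have "is_arg_min (\<lambda>t. (form_norm a (w - t *\<^sub>R k))\<^sup>2) (\<lambda>_. True) (\<xi> m s)"
    using steps unfolding optimal_steps_def w_def k_def by (auto simp flip: x)
  then have \<xi>: "\<xi> m s * a k k = a w k" by (rule minimal_multiple)
  have "\<xi> m s *\<^sub>R k = a w (direction (s m) (u - x)) *\<^sub>R direction (s m) (u - x)"
  proof (cases "k = 0")
    case False
    then have "\<xi> m s = a w k / a k k" using \<xi> positive[of k] by (simp add: field_simps)
    then show ?thesis
      using False norm_square[of k]
      by (simp add: direction_def form.scaleR_right power2_eq_square divide_simps flip: k_def)
  qed (simp add: direction_def flip: k_def)
  then show ?case by (simp add: x flip: x_def w_def k_def)
qed simp

lemma projected_iterate_cong:
  "(\<And>i. i < m \<Longrightarrow> s i = s' i) \<Longrightarrow> projected_iterate u m s = projected_iterate u m s'"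
  by (induction m) (simp_all del: fun_upd_apply)

lemma projected_iterate_optimal:
  "(form_norm a (u - projected_iterate u (Suc m) s))\<^sup>2
     \<le> (form_norm a (u - relax m *\<^sub>R projected_iterate u m s
            - t *\<^sub>R direction (s m) (u - projected_iterate u m s)))\<^sup>2"
proof -
  define x where "x = projected_iterate u m s"
  define p where "p = direction (s m) (u - x)"
  define w where "w = u - relax m *\<^sub>R x"
  have "u - projected_iterate u (Suc m) s = w - a w p *\<^sub>R p"
    by (simp add: w_def p_def flip: x_def)
  moreover have "(form_norm a (w - a w p *\<^sub>R p))\<^sup>2 \<le> (form_norm a (w - t *\<^sub>R p))\<^sup>2"
  proof (cases "p = 0")
    case False
    then have "a p p = 1" using direction_normalised unfolding p_def by simp
    then have "(form_norm a (w - t *\<^sub>R p))\<^sup>2 - (form_norm a (w - a w p *\<^sub>R p))\<^sup>2 = (t - a w p)\<^sup>2"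
      unfolding square_norm_diff_scale by (simp add: power2_eq_square algebra_simps)
    then show ?thesis using zero_le_power2[of "t - a w p"] by linarith
  qed simp
  ultimately show ?thesis by (simp only: x_def w_def p_def)
qed

lemma error_le_initial: "form_norm a (u - projected_iterate u m s) \<le> form_norm a u"
proof (induction m)
  case (Suc m)
  let ?x = "projected_iterate u m s"
  have "form_norm a (u - projected_iterate u (Suc m) s) \<le> form_norm a (u - relax m *\<^sub>R ?x)"
    by (rule power2_le_imp_le[OF projected_iterate_optimal[of u m s 0, unfolded scaleR_zero_left diff_0_right]])
      (rule norm_nonneg, rule UNIV_I)
  also have "u - relax m *\<^sub>R ?x = relax m *\<^sub>R (u - ?x) + (1 - relax m) *\<^sub>R u"
    by (simp add: algebra_simps)
  also have "form_norm a \<dots> \<le> relax m * form_norm a (u - ?x) + (1 - relax m) * form_norm a u"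
    using norm_triangle[of "relax m *\<^sub>R (u - ?x)" "(1 - relax m) *\<^sub>R u"] relax_nonneg[of m] relax_less_1[of m]
    by (simp add: norm_scale)
  also have "\<dots> \<le> relax m * form_norm a u + (1 - relax m) * form_norm a u"
    by (intro add_right_mono mult_left_mono Suc.IH relax_nonneg)
  finally show ?case by (simp add: algebra_simps)
qed simp

text \<open>
  The step is compared with the point \<open>(1 - relax m) * \<tau>\<close> on the search line, with \<open>\<tau>\<close> from
  \<open>correlation_bound\<close>. The result no longer involves the search direction: the new sample enters
  it linearly, through \<open>R (s m) w\<close>, and through the norm of \<open>w\<close>.
\<close>

lemma one_step_bound:
  fixes u :: 'v and m :: nat and s :: "nat \<Rightarrow> 'o"
  assumes \<omega>: "s m \<in> space \<rho>" and w: "w \<in> W (s m)"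
  defines "e \<equiv> u - projected_iterate u m s"
  shows "(form_norm a (u - projected_iterate u (Suc m) s))\<^sup>2
    \<le> (relax m)\<^sup>2 * (form_norm a e)\<^sup>2
       + 2 * relax m * (1 - relax m) * (a e u - a e (R (s m) w))
       + (1 - relax m)\<^sup>2 * (form_norm a u + \<bar>\<Lambda>\<bar> * form_norm (aw (s m)) w)\<^sup>2"
proof -
  define \<tau> where "\<tau> = \<Lambda> * form_norm (aw (s m)) w"
  define p where "p = direction (s m) e"
  define z where "z = u - \<tau> *\<^sub>R p"
  let ?q = "1 - relax m"
  have \<tau>: "0 \<le> \<tau>" "\<tau> = \<bar>\<Lambda>\<bar> * form_norm (aw (s m)) w"
    unfolding \<tau>_def by (rule \<Lambda>_norm_nonneg[OF \<omega> w], rule \<Lambda>_norm_abs[OF \<omega> w])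
  have "u - relax m *\<^sub>R projected_iterate u m s - (?q * \<tau>) *\<^sub>R p = relax m *\<^sub>R e + ?q *\<^sub>R z"
    by (simp add: e_def z_def algebra_simps)
  then have "(form_norm a (u - projected_iterate u (Suc m) s))\<^sup>2 \<le> (form_norm a (relax m *\<^sub>R e + ?q *\<^sub>R z))\<^sup>2"
    using projected_iterate_optimal[of u m s "?q * \<tau>"] by (simp only: e_def p_def)
  also have "\<dots> = (relax m)\<^sup>2 * (form_norm a e)\<^sup>2 + 2 * relax m * ?q * a e z + ?q\<^sup>2 * (form_norm a z)\<^sup>2"
    by (simp only: norm_square UNIV_I form.add_left form.add_right form.scaleR_left form.scaleR_right
        symmetric[of z e]) (simp add: power2_eq_square algebra_simps)
  also have "\<dots> \<le> (relax m)\<^sup>2 * (form_norm a e)\<^sup>2 + 2 * relax m * ?q * (a e u - a e (R (s m) w))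
     + ?q\<^sup>2 * (form_norm a u + \<tau>)\<^sup>2"
  proof (intro add_mono mult_left_mono power_mono order_refl)
    show "a e z \<le> a e u - a e (R (s m) w)"
      using correlation_bound[OF \<omega> w, of e]
      by (simp add: z_def form.diff_right form.scaleR_right \<tau>_def p_def)
    have "form_norm a p \<le> 1"
      using direction_normalised[of "s m" e] by (simp add: form_norm_def p_def)
    then have "\<tau> * form_norm a p \<le> \<tau>" using \<tau>(1) by (rule mult_left_le)
    then show "form_norm a z \<le> form_norm a u + \<tau>"
      using norm_triangle[of u "- \<tau> *\<^sub>R p"] norm_scale[of p "- \<tau>"] \<tau>(1) by (simp add: z_def)
  qed (use relax_nonneg[of m] relax_less_1[of m] in \<open>auto simp: norm_nonneg\<close>)
  finally show ?thesis unfolding \<tau>(2) .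
qed

end


section \<open>Measurability of the iterates\<close>

locale measurable_random_subspaces = random_subspaces a \<rho> W aw R T \<Lambda>
  for a :: "'v::{real_inner, banach, second_countable_topology} \<Rightarrow> 'v \<Rightarrow> real"
    and \<rho> :: "'o measure" and W :: "'o \<Rightarrow> 'w::real_vector set"
    and aw :: "'o \<Rightarrow> 'w \<Rightarrow> 'w \<Rightarrow> real" and R :: "'o \<Rightarrow> 'w \<Rightarrow> 'v" and T :: "'o \<Rightarrow> 'v \<Rightarrow> 'w"
    and \<Lambda> :: real +
  assumes direction_measurable: "(\<lambda>\<omega>. direction \<omega> e) \<in> borel_measurable \<rho>"
begin

text \<open>
  By symmetry of the correction operator, its kernel is the orthogonal complement of its range, and
  orthogonality to the range can be tested on the directions of a countable dense set of vectors. These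
  are measurable by hypothesis.
\<close>

lemma kernel_jointly_measurable:
  "{z \<in> space (\<rho> \<Otimes>\<^sub>M borel). R (fst z) (T (fst z) (snd z)) = 0} \<in> sets (\<rho> \<Otimes>\<^sub>M borel)"
proof -
  obtain D :: "'v set" where D: "countable D" "\<And>X. open X \<Longrightarrow> X \<noteq> {} \<Longrightarrow> \<exists>d\<in>D. d \<in> X"
    by (erule countable_dense_setE)
  have "R (fst z) (T (fst z) (snd z)) = 0 \<longleftrightarrow> (\<forall>d\<in>D. a (snd z) (direction (fst z) d) = 0)"
    if "z \<in> space (\<rho> \<Otimes>\<^sub>M borel)" for z
  proof -
    have \<omega>: "fst z \<in> space \<rho>" using that by (auto simp: space_pair_measure)
    have "(\<forall>d\<in>D. a (snd z) (direction (fst z) d) = 0)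
      \<longleftrightarrow> (\<forall>d\<in>D. a (R (fst z) (T (fst z) (snd z))) d = 0)"
      by (simp add: orthogonal_direction_iff correction_symmetric[OF \<omega>])
    also have "\<dots> \<longleftrightarrow> R (fst z) (T (fst z) (snd z)) = 0"
      using eq_0_of_orthogonal_dense[OF D(2)] by (auto simp: form.zero_left)
    finally show ?thesis by simp
  qed
  then have "{z \<in> space (\<rho> \<Otimes>\<^sub>M borel). R (fst z) (T (fst z) (snd z)) = 0}
    = {z \<in> space (\<rho> \<Otimes>\<^sub>M borel). \<forall>d\<in>D. a (snd z) (direction (fst z) d) = 0}"
    by blast
  also have "\<dots> \<in> sets (\<rho> \<Otimes>\<^sub>M borel)"
  proof (rule sets.sets_Collect_countable_All'[OF _ D(1)])
    fix d
    have [measurable]: "(\<lambda>\<omega>. direction \<omega> d) \<in> borel_measurable \<rho>"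
      by (rule direction_measurable)
    show "{z \<in> space (\<rho> \<Otimes>\<^sub>M borel). a (snd z) (direction (fst z) d) = 0} \<in> sets (\<rho> \<Otimes>\<^sub>M borel)"
      by measurable
  qed
  finally show ?thesis .
qed

text \<open>
  Off the kernel, \<open>direction \<omega>\<close> is continuous, so \<open>e\<close> may be replaced by simple functions converging to
  it; on the kernel, where continuity may fail, the value is 0 by definition.
\<close>

lemma direction_jointly_measurable:
  "(\<lambda>z. direction (fst z) (snd z)) \<in> borel_measurable (\<rho> \<Otimes>\<^sub>M borel)"
proof -
  have "(\<lambda>e::'v. e) \<in> borel_measurable borel" by simp
  from borel_measurable_implies_sequence_metric[OF this, of 0] obtain F :: "nat \<Rightarrow> 'v \<Rightarrow> 'v"
    where F: "\<And>k. simple_function borel (F k)" "\<And>e. (\<lambda>k. F k e) \<longlonglongrightarrow> e"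
    by auto
  let ?ker = "\<lambda>z. R (fst z) (T (fst z) (snd z)) = 0"
  define g where "g k z = (if ?ker z then 0 else direction (fst z) (F k (snd z)))" for k z
  have g: "g k \<in> borel_measurable (\<rho> \<Otimes>\<^sub>M borel)" for k
    unfolding g_def
  proof (rule measurable_If[OF _ _ kernel_jointly_measurable])
    show "(\<lambda>z. direction (fst z) (F k (snd z))) \<in> borel_measurable (\<rho> \<Otimes>\<^sub>M borel)"
    proof (rule measurable_compose_countable'[where f = "\<lambda>d z. direction (fst z) d"
          and g = "\<lambda>z. F k (snd z)" and I = "range (F k)"])
      have fin: "finite (range (F k))" using F(1)[of k] by (simp add: simple_function_def)
      then show "countable (range (F k))" by (rule countable_finite)
      have "F k \<in> borel \<rightarrow>\<^sub>M count_space (range (F k))"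
        using fin F(1)[of k] by (simp add: measurable_count_space_eq2 simple_function_def)
      then show "(\<lambda>z. F k (snd z)) \<in> \<rho> \<Otimes>\<^sub>M borel \<rightarrow>\<^sub>M count_space (range (F k))"
        by (rule measurable_compose[OF measurable_snd])
      show "(\<lambda>z. direction (fst z) d) \<in> borel_measurable (\<rho> \<Otimes>\<^sub>M borel)" for d
        by (rule measurable_compose[OF measurable_fst direction_measurable])
    qed
  qed simp
  have "(\<lambda>k. g k z) \<longlonglongrightarrow> direction (fst z) (snd z)" if "z \<in> space (\<rho> \<Otimes>\<^sub>M borel)" for z
  proof (cases "?ker z")
    case False
    moreover have "fst z \<in> space \<rho>" using that by (auto simp: space_pair_measure)
    ultimately show ?thesis using direction_tendsto[OF _ F(2)] by (simp add: g_def)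
  qed (simp add: g_def direction_def)
  then show ?thesis by (rule borel_measurable_LIMSEQ_metric[OF g])
qed

lemma projected_iterate_measurable:
  "m \<le> n \<Longrightarrow> projected_iterate u m \<in> borel_measurable (sample_measure \<rho> n)"
proof (induction m)
  case (Suc m)
  have [measurable]: "projected_iterate u m \<in> borel_measurable (sample_measure \<rho> n)"
    using Suc by simp
  have "(\<lambda>s. s m) \<in> sample_measure \<rho> n \<rightarrow>\<^sub>M \<rho>"
    using Suc.prems by (intro measurable_component_singleton) simp
  then have "(\<lambda>s. (s m, u - projected_iterate u m s)) \<in> sample_measure \<rho> n \<rightarrow>\<^sub>M \<rho> \<Otimes>\<^sub>M borel"
    by measurable
  from measurable_compose[OF this direction_jointly_measurable]
  have [measurable]: "(\<lambda>s. direction (s m) (u - projected_iterate u m s)) \<in> borel_measurable (sample_measure \<rho> n)"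
    by simp
  show ?case unfolding projected_iterate.simps by measurable
next
  case 0
  have "projected_iterate u 0 = (\<lambda>s. 0)" by (rule ext) simp
  then show ?case by simp
qed


section \<open>Expected errors\<close>

definition expected_sq_error :: "'v \<Rightarrow> nat \<Rightarrow> real" where
  "expected_sq_error u m = (\<integral>s. (form_norm a (u - projected_iterate u m s))\<^sup>2 \<partial>sample_measure \<rho> m)"

lemma prob_space_samples: "prob_space (sample_measure \<rho> m)"
  by (intro prob_space_PiM prob_space_axioms)

lemma error_measurable:
  "(\<lambda>s. form_norm a (u - projected_iterate u m s)) \<in> borel_measurable (sample_measure \<rho> m)"
proof -
  note [measurable] = projected_iterate_measurable[OF order_refl, of u m]
  show ?thesis unfolding form_norm_def by measurable
qed

lemma error_integrable: "integrable (sample_measure \<rho> m) (\<lambda>s. form_norm a (u - projected_iterate u m s))"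
  and sq_error_integrable:
    "integrable (sample_measure \<rho> m) (\<lambda>s. (form_norm a (u - projected_iterate u m s))\<^sup>2)"
proof -
  interpret S: prob_space "sample_measure \<rho> m" by (rule prob_space_samples)
  note [measurable] = error_measurable[of u m]
  show "integrable (sample_measure \<rho> m) (\<lambda>s. form_norm a (u - projected_iterate u m s))"
    by (rule S.integrable_const_bound[of _ "form_norm a u"]) (auto simp: error_le_initial norm_nonneg)
  show "integrable (sample_measure \<rho> m) (\<lambda>s. (form_norm a (u - projected_iterate u m s))\<^sup>2)"
    by (rule S.integrable_const_bound[of _ "(form_norm a u)\<^sup>2"])
      (auto intro!: power_mono simp: error_le_initial norm_nonneg)
qed

lemma expected_sq_error_nonneg: "0 \<le> expected_sq_error u m"
  by (simp add: expected_sq_error_def)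

lemma expected_sq_error_le_initial: "expected_sq_error u m \<le> (form_norm a u)\<^sup>2"
proof -
  interpret S: prob_space "sample_measure \<rho> m" by (rule prob_space_samples)
  show ?thesis unfolding expected_sq_error_def
    by (intro S.integral_le_const sq_error_integrable AE_I2 power_mono error_le_initial norm_nonneg) simp
qed

end

lemma (in prob_space) expectation_le_sqrt_second_moment:
  fixes X :: "'a \<Rightarrow> real"
  assumes "integrable M X" "integrable M (\<lambda>x. (X x)\<^sup>2)"
  shows "expectation X \<le> sqrt (expectation (\<lambda>x. (X x)\<^sup>2))"
  using variance_positive[of X] variance_eq[OF assms] by (intro real_le_rsqrt) simp

lemma (in prob_space) expectation_square_add_le:
  fixes X :: "'a \<Rightarrow> real"
  assumes X: "X \<in> borel_measurable M" "integrable M (\<lambda>x. (X x)\<^sup>2)" and nonneg: "0 \<le> c" "0 \<le> l"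
  shows "integrable M (\<lambda>x. (c + l * X x)\<^sup>2)"
    and "expectation (\<lambda>x. (c + l * X x)\<^sup>2) \<le> (c + l * sqrt (expectation (\<lambda>x. (X x)\<^sup>2)))\<^sup>2"
proof -
  have int: "integrable M X" by (rule square_integrable_imp_integrable[OF X])
  have eq: "(\<lambda>x. (c + l * X x)\<^sup>2) = (\<lambda>x. c\<^sup>2 + 2 * c * l * X x + l\<^sup>2 * (X x)\<^sup>2)"
    by (simp add: power2_sum power_mult_distrib mult.assoc ac_simps)
  show "integrable M (\<lambda>x. (c + l * X x)\<^sup>2)" unfolding eq using int X(2) by simp
  let ?H = "sqrt (expectation (\<lambda>x. (X x)\<^sup>2))"
  have H: "?H\<^sup>2 = expectation (\<lambda>x. (X x)\<^sup>2)" by simp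
  have "expectation (\<lambda>x. (c + l * X x)\<^sup>2) = c\<^sup>2 + 2 * c * l * expectation X + l\<^sup>2 * ?H\<^sup>2"
    unfolding eq H using int X(2) by (simp add: prob_space)
  also have "\<dots> \<le> c\<^sup>2 + 2 * c * l * ?H + l\<^sup>2 * ?H\<^sup>2"
    using nonneg expectation_le_sqrt_second_moment[OF int X(2)]
    by (intro add_right_mono add_left_mono mult_left_mono) auto
  also have "\<dots> = (c + l * ?H)\<^sup>2" by (simp only: power2_sum power_mult_distrib mult.assoc)
  finally show "expectation (\<lambda>x. (c + l * X x)\<^sup>2) \<le> (c + l * ?H)\<^sup>2" .
qed

context measurable_random_subspaces
begin

abbreviation cost :: "('o \<Rightarrow> 'w) \<Rightarrow> real" where
  "cost v \<equiv> sqrt (\<integral>\<omega>. (form_norm (aw \<omega>) (v \<omega>))\<^sup>2 \<partial>\<rho>)"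

text \<open>
  With the earlier samples held fixed, the bound of \<open>one_step_bound\<close> can be averaged exactly over the next
  one: \<open>R \<omega> (v \<omega>)\<close> enters it linearly and has mean \<open>h\<close>.
\<close>

lemma expected_step_bound:
  fixes u :: 'v and m :: nat and s :: "nat \<Rightarrow> 'o"
  assumes rep: "A2_representation \<rho> W aw R h v"
  defines "e \<equiv> u - projected_iterate u m s"
  shows "(\<integral>\<omega>. (form_norm a (u - projected_iterate u (Suc m) (s(m := \<omega>))))\<^sup>2 \<partial>\<rho>)
    \<le> (relax m)\<^sup>2 * (form_norm a e)\<^sup>2
       + 2 * relax m * (1 - relax m) * form_norm a (u - h) * form_norm a e
       + (1 - relax m)\<^sup>2 * (form_norm a u + \<bar>\<Lambda>\<bar> * cost v)\<^sup>2"
proof -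
  let ?q = "1 - relax m" and ?n = "\<lambda>\<omega>. form_norm (aw \<omega>) (v \<omega>)"
  have v: "\<And>\<omega>. \<omega> \<in> space \<rho> \<Longrightarrow> v \<omega> \<in> W \<omega>" and n: "?n \<in> borel_measurable \<rho>"
      "integrable \<rho> (\<lambda>\<omega>. (?n \<omega>)\<^sup>2)" and hbi: "has_bochner_integral \<rho> (\<lambda>\<omega>. R \<omega> (v \<omega>)) h"
    using rep by (auto simp: A2_representation_def)
  have int_h: "integrable \<rho> (\<lambda>\<omega>. a e (R \<omega> (v \<omega>)))" "(\<integral>\<omega>. a e (R \<omega> (v \<omega>)) \<partial>\<rho>) = a e h"
    using has_bochner_integral_bounded_linear[OF form.bounded_linear_right hbi, of e]
    by (auto simp: has_bochner_integral_iff)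
  note moment = expectation_square_add_le[OF n norm_nonneg[OF UNIV_I, of u] abs_ge_zero[of \<Lambda>]]
  define g where "g \<omega> = (relax m)\<^sup>2 * (form_norm a e)\<^sup>2
     + 2 * relax m * ?q * (a e u - a e (R \<omega> (v \<omega>))) + ?q\<^sup>2 * (form_norm a u + \<bar>\<Lambda>\<bar> * ?n \<omega>)\<^sup>2" for \<omega>
  have g_int: "integrable \<rho> g" unfolding g_def using int_h(1) moment(1) by simp
  have le_g: "(form_norm a (u - projected_iterate u (Suc m) (s(m := \<omega>))))\<^sup>2 \<le> g \<omega>"
    if \<omega>: "\<omega> \<in> space \<rho>" for \<omega>
  proof -
    have "projected_iterate u m (s(m := \<omega>)) = projected_iterate u m s"
      by (rule projected_iterate_cong) simp
    then show ?thesis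
      using one_step_bound[of "s(m := \<omega>)" m "v \<omega>" u] \<omega> v[OF \<omega>]
      by (simp only: g_def e_def fun_upd_same)
  qed
  have "(\<integral>\<omega>. (form_norm a (u - projected_iterate u (Suc m) (s(m := \<omega>))))\<^sup>2 \<partial>\<rho>) \<le> (\<integral>\<omega>. g \<omega> \<partial>\<rho>)"
    by (rule integral_mono'[OF g_int le_g]) (auto intro: order_trans[OF zero_le_power2 le_g])
  also have "\<dots> = (relax m)\<^sup>2 * (form_norm a e)\<^sup>2 + 2 * relax m * ?q * a e (u - h)
     + ?q\<^sup>2 * (\<integral>\<omega>. (form_norm a u + \<bar>\<Lambda>\<bar> * ?n \<omega>)\<^sup>2 \<partial>\<rho>)"
    unfolding g_def using int_h moment(1) by (simp add: prob_space form.diff_right)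
  also have "\<dots> \<le> (relax m)\<^sup>2 * (form_norm a e)\<^sup>2
     + 2 * relax m * ?q * (form_norm a (u - h) * form_norm a e)
     + ?q\<^sup>2 * (form_norm a u + \<bar>\<Lambda>\<bar> * cost v)\<^sup>2"
  proof (intro add_mono mult_left_mono order_refl moment(2))
    show "a e (u - h) \<le> form_norm a (u - h) * form_norm a e"
      using Cauchy_Schwarz[of e "u - h"] by (simp add: mult.commute)
  qed (use relax_nonneg[of m] relax_less_1[of m] in auto)
  finally show ?thesis by (simp only: mult.assoc)
qed

text \<open>
  The last sample is independent of the others, so Fubini's theorem allows \<open>expected_step_bound\<close> to be
  averaged over the earlier ones. The expected error that appears is at most the root of the
  expected squared error, which closes the recursion.
\<close>

lemma expected_sq_error_recursion:
  fixes u :: 'v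
  assumes rep: "A2_representation \<rho> W aw R h v"
  defines "x \<equiv> form_norm a (u - h)" and "B \<equiv> \<bar>\<Lambda>\<bar> * cost v + form_norm a h"
  shows "expected_sq_error u (Suc m)
    \<le> (relax m * sqrt (expected_sq_error u m) + (1 - relax m) * x)\<^sup>2
       + (1 - relax m)\<^sup>2 * (2 * x * B + B\<^sup>2)"
proof -
  let ?q = "1 - relax m" and ?P = "sample_measure \<rho> m"
  let ?d = "\<lambda>s. form_norm a (u - projected_iterate u m s)"
  interpret S: prob_space ?P by (rule prob_space_samples)
  interpret product_sigma_finite "\<lambda>_::nat. \<rho>"
    by (intro product_sigma_finite.intro prob_space_imp_sigma_finite prob_space_axioms)
  define E where "E = form_norm a u + \<bar>\<Lambda>\<bar> * cost v"
  define f where "f s = (relax m)\<^sup>2 * (?d s)\<^sup>2 + 2 * relax m * ?q * x * ?d s + ?q\<^sup>2 * E\<^sup>2" for s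
  have q: "0 \<le> ?q" using relax_less_1[of m] by simp
  have x: "0 \<le> x" by (simp add: x_def norm_nonneg)
  have f_int: "integrable ?P f"
    unfolding f_def using sq_error_integrable error_integrable by simp
  have f_nonneg: "0 \<le> f s" for s
    unfolding f_def using q x relax_nonneg[of m] norm_nonneg by simp
  have "expected_sq_error u (Suc m)
    = (\<integral>s. (\<integral>\<omega>. (form_norm a (u - projected_iterate u (Suc m) (s(m := \<omega>))))\<^sup>2 \<partial>\<rho>) \<partial>?P)"
    using product_integral_insert[of "{..<m}" m "\<lambda>s. (form_norm a (u - projected_iterate u (Suc m) s))\<^sup>2"]
      sq_error_integrable[where m = "Suc m"]
    by (simp only: expected_sq_error_def lessThan_Suc finite_lessThan lessThan_iff less_irrefl not_False_eq_True)
  also have "\<dots> \<le> (\<integral>s. f s \<partial>?P)"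
    using f_int expected_step_bound[OF rep, of u m] f_nonneg
    unfolding f_def x_def E_def by (rule integral_mono')
  also have "\<dots> = (relax m)\<^sup>2 * expected_sq_error u m + 2 * relax m * ?q * x * (\<integral>s. ?d s \<partial>?P) + ?q\<^sup>2 * E\<^sup>2"
    unfolding f_def expected_sq_error_def
    using sq_error_integrable error_integrable by (simp add: S.prob_space)
  also have "\<dots> \<le> (relax m)\<^sup>2 * expected_sq_error u m
      + 2 * relax m * ?q * x * sqrt (expected_sq_error u m) + ?q\<^sup>2 * (x + B)\<^sup>2"
  proof (intro add_mono mult_left_mono power_mono order_refl)
    show "(\<integral>s. ?d s \<partial>?P) \<le> sqrt (expected_sq_error u m)"
      unfolding expected_sq_error_def
      by (rule S.expectation_le_sqrt_second_moment[OF error_integrable sq_error_integrable])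
    show "E \<le> x + B"
      using norm_triangle[of "u - h" h] by (simp add: E_def B_def x_def)
    show "0 \<le> E" by (simp add: E_def norm_nonneg)
  qed (use q x relax_nonneg[of m] in auto)
  also have "\<dots> = (relax m * sqrt (expected_sq_error u m) + ?q * x)\<^sup>2 + ?q\<^sup>2 * (2 * x * B + B\<^sup>2)"
    using real_sqrt_pow2[OF expected_sq_error_nonneg[of u m]]
    unfolding power2_sum power_mult_distrib by (simp add: algebra_simps)
  finally show ?thesis .
qed

lemma \<Lambda>_cost:
  assumes "A2_representation \<rho> W aw R h v"
  shows "\<Lambda> * cost v = \<bar>\<Lambda>\<bar> * cost v"
proof (cases "0 \<le> \<Lambda>")
  case False
  have "form_norm (aw \<omega>) (v \<omega>) = 0" if "\<omega> \<in> space \<rho>" for \<omega>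
    using False \<Lambda>_norm_abs[OF that, of "v \<omega>"] assms that by (auto simp: A2_representation_def)
  then have "(\<integral>\<omega>. (form_norm (aw \<omega>) (v \<omega>))\<^sup>2 \<partial>\<rho>) = (\<integral>\<omega>. 0 \<partial>\<rho>)"
    by (intro Bochner_Integration.integral_cong) auto
  then show ?thesis by simp
qed simp

lemma error_bound_of_representation:
  assumes rep: "A2_representation \<rho> W aw R h v"
  shows "sqrt (expected_sq_error u m) \<le> 2 * (form_norm a (u - h)
      + sqrt ((\<Lambda> * cost v + form_norm a h)\<^sup>2 + (form_norm a u)\<^sup>2) / sqrt (real m + 1))"
  unfolding \<Lambda>_cost[OF rep]
proof (rule relaxed_recursion_rate[OF expected_sq_error_nonneg _ expected_sq_error_recursion[OF rep]])
  let ?B = "\<bar>\<Lambda>\<bar> * cost v + form_norm a h"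
  show "expected_sq_error u 0 \<le> (sqrt (?B\<^sup>2 + (form_norm a u)\<^sup>2))\<^sup>2"
    using expected_sq_error_le_initial[of u 0] by (simp add: add_increasing)
  show "?B \<le> sqrt (?B\<^sup>2 + (form_norm a u)\<^sup>2)" by (rule real_le_rsqrt) simp
qed (simp_all add: norm_nonneg)

lemma error_bound:
  assumes "h \<in> A2 \<rho> W aw R"
  shows "sqrt (expected_sq_error u m) \<le> 2 * (form_norm a (u - h)
      + sqrt ((\<Lambda> * A2_norm \<rho> W aw R h + form_norm a h)\<^sup>2 + (form_norm a u)\<^sup>2) / sqrt (real m + 1))"
proof -
  \<comment> \<open>The bound holds for the cost of every representation, and it is a closed condition on the cost.\<close>
  let ?costs = "cost ` {v. A2_representation \<rho> W aw R h v}"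
  let ?good = "{t. sqrt (expected_sq_error u m) \<le> 2 * (form_norm a (u - h)
      + sqrt ((\<Lambda> * t + form_norm a h)\<^sup>2 + (form_norm a u)\<^sup>2) / sqrt (real m + 1))}"
  have "?costs \<noteq> {}" using assms by (auto simp: A2_def)
  moreover have "bdd_below ?costs" by (intro bdd_belowI[of _ 0]) auto
  ultimately have "Inf ?costs \<in> closure ?costs" by (rule closure_contains_Inf)
  moreover have "closed ?good" by (intro closed_Collect_le continuous_intros) simp
  moreover have "?costs \<subseteq> ?good" using error_bound_of_representation by auto
  ultimately have "Inf ?costs \<in> ?good" by (meson closure_minimal subsetD)
  then show ?thesis by (simp add: A2_norm_def)
qed

lemma expected_sq_error_tendsto_0:
  assumes "u \<in> closure (A2 \<rho> W aw R)"
  shows "expected_sq_error u \<longlonglongrightarrow> 0"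
proof -
  obtain C where C: "0 < C" "\<And>x. form_norm a x \<le> C * norm x" by (rule norm_bound) blast
  have "(\<lambda>m. sqrt (expected_sq_error u m)) \<longlonglongrightarrow> 0"
  proof (rule order_tendstoI)
    fix r :: real assume "0 < r"
    then obtain h where h: "h \<in> A2 \<rho> W aw R" "dist h u < r / (2 * C)"
      using assms C(1) unfolding closure_approachable by (meson divide_pos_pos mult_pos_pos zero_less_numeral)
    define K where "K = sqrt ((\<Lambda> * A2_norm \<rho> W aw R h + form_norm a h)\<^sup>2 + (form_norm a u)\<^sup>2)"
    have "(\<lambda>m. K / sqrt (real m + 1)) \<longlonglongrightarrow> 0"
      by (intro real_tendsto_divide_at_top[OF tendsto_const] filterlim_compose[OF sqrt_at_top]
          filterlim_tendsto_add_at_top[OF tendsto_const, of _ _ 1, unfolded add.commute[of 1]]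
          filterlim_real_sequentially)
    then have "(\<lambda>m. 2 * (form_norm a (u - h) + K / sqrt (real m + 1))) \<longlonglongrightarrow> 2 * (form_norm a (u - h) + 0)"
      by (intro tendsto_intros)
    moreover have "form_norm a (u - h) < r / 2"
      using C(2)[of "u - h"] h(2) C(1) by (simp add: dist_norm norm_minus_commute[of h] field_simps)
    then have "2 * (form_norm a (u - h) + 0) < r" by simp
    ultimately have "\<forall>\<^sub>F m in sequentially. 2 * (form_norm a (u - h) + K / sqrt (real m + 1)) < r"
      by (rule order_tendstoD(2))
    then show "\<forall>\<^sub>F m in sequentially. sqrt (expected_sq_error u m) < r"
      by eventually_elim (use error_bound[OF h(1), of u] in \<open>auto simp: K_def intro: le_less_trans\<close>)
  next
    fix r :: real assume "r < 0"
    then show "\<forall>\<^sub>F m in sequentially. r < sqrt (expected_sq_error u m)"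
      by (intro always_eventually allI less_le_trans[OF _ real_sqrt_ge_zero] expected_sq_error_nonneg)
  qed
  from tendsto_power[OF this, of 2] show ?thesis
    by (simp add: expected_sq_error_nonneg)
qed

end


section \<open>The error estimate for the algorithm\<close>

theorem theorem2:
  fixes a :: "'v::{real_inner, banach, second_countable_topology} \<Rightarrow> 'v \<Rightarrow> real"
    and F :: "'v \<Rightarrow> real" and u :: 'v
    and \<rho> :: "'o measure"
    and W :: "'o \<Rightarrow> 'w::real_vector set"
    and ip aw :: "'o \<Rightarrow> 'w \<Rightarrow> 'w \<Rightarrow> real"
    and R :: "'o \<Rightarrow> 'w \<Rightarrow> 'v" and T :: "'o \<Rightarrow> 'v \<Rightarrow> 'w"
    and \<Lambda> :: real
    and \<xi> :: "nat \<Rightarrow> (nat \<Rightarrow> 'o) \<Rightarrow> real"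
  assumes a_continuous: "bounded_bilinear a"
    and a_symmetric: "\<And>x y. a x y = a y x"
    and a_coercive: "coercive a"
    and F: "bounded_linear F"
    and u: "\<And>v. a u v = F v"
    and rho: "prob_space \<rho>"
    and W_hilbert: "\<And>\<omega>. \<omega> \<in> space \<rho> \<Longrightarrow> separable_hilbert_on (W \<omega>) (ip \<omega>)"
    and aw_product: "\<And>\<omega>. \<omega> \<in> space \<rho> \<Longrightarrow> scalar_product_on (W \<omega>) (aw \<omega>)"
    and aw_equivalent: "\<And>\<omega>. \<omega> \<in> space \<rho> \<Longrightarrow> spectrally_equivalent_on (W \<omega>) (ip \<omega>) (aw \<omega>)"
    and R_linear: "\<And>\<omega>. \<omega> \<in> space \<rho> \<Longrightarrow> linear_map_on (W \<omega>) (R \<omega>)"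
    and R_kernel: "\<And>\<omega>. \<omega> \<in> space \<rho> \<Longrightarrow> {w \<in> W \<omega>. R \<omega> w = 0} = {0}"
    and R_bound: "\<And>\<omega> w. \<omega> \<in> space \<rho> \<Longrightarrow> w \<in> W \<omega> \<Longrightarrow> form_norm (aw \<omega>) w = 1 \<Longrightarrow>
                    form_norm a (R \<omega> w) \<le> \<Lambda>"
    and T_range: "\<And>\<omega> v. \<omega> \<in> space \<rho> \<Longrightarrow> T \<omega> v \<in> W \<omega>"
    and T_adjoint: "\<And>\<omega> v w. \<omega> \<in> space \<rho> \<Longrightarrow> w \<in> W \<omega> \<Longrightarrow> aw \<omega> (T \<omega> v) w = a v (R \<omega> w)"
    and psi_measurable: "\<And>e. (\<lambda>\<omega>. if R \<omega> (T \<omega> e) \<noteq> 0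
                    then R \<omega> (T \<omega> e) /\<^sub>R form_norm a (R \<omega> (T \<omega> e)) else 0) \<in> borel_measurable \<rho>"
    and steps: "optimal_steps a (space \<rho>) R T u \<xi>"
  shows "(\<forall>m. integrable (sample_measure \<rho> m) (sq_error a R T u \<xi> m)) \<and>
         (\<forall>m. \<forall>h \<in> A2 \<rho> W aw R.
            sqrt (\<integral>s. sq_error a R T u \<xi> m s \<partial>sample_measure \<rho> m)
              \<le> 2 * (form_norm a (u - h)
                     + sqrt ((\<Lambda> * A2_norm \<rho> W aw R h + form_norm a h)\<^sup>2 + (form_norm a u)\<^sup>2)
                       / sqrt (real m + 1))) \<and>
         (u \<in> closure (A2 \<rho> W aw R) \<longrightarrow>
            (\<lambda>m. \<integral>s. sq_error a R T u \<xi> m s \<partial>sample_measure \<rho> m) \<longlonglongrightarrow> 0)"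
proof -
  interpret energy_form a
    by (intro energy_form.intro energy_form_axioms.intro a_continuous a_symmetric a_coercive)
  interpret prob_space \<rho> by (rule rho)
  interpret random_subspaces a \<rho> W aw R T \<Lambda>
  proof unfold_locales
    fix \<omega> assume "\<omega> \<in> space \<rho>"
    then show "subspace (W \<omega>)" "scalar_product_on (W \<omega>) (aw \<omega>)"
      using W_hilbert aw_product by (auto simp: separable_hilbert_on_def)
  qed (fact R_linear R_kernel R_bound T_range T_adjoint)+
  interpret measurable_random_subspaces a \<rho> W aw R T \<Lambda>
    by unfold_locales (simp add: direction_def psi_measurable)
  have sq_error: "sq_error a R T u \<xi> m s = (form_norm a (u - projected_iterate u m s))\<^sup>2"
    if "s \<in> space (sample_measure \<rho> m)" for m s
    using that iterate_eq_projected_iterate[OF steps, of s m]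
    by (auto simp: sq_error_def space_PiM PiE_def)
  have expected: "(\<integral>s. sq_error a R T u \<xi> m s \<partial>sample_measure \<rho> m) = expected_sq_error u m" for m
    unfolding expected_sq_error_def by (rule Bochner_Integration.integral_cong[OF refl sq_error])
  have "integrable (sample_measure \<rho> m) (sq_error a R T u \<xi> m)" for m
    by (rule iffD2[OF Bochner_Integration.integrable_cong[OF refl sq_error] sq_error_integrable])
  then show ?thesis
    unfolding expected using error_bound expected_sq_error_tendsto_0 by simp
qed

end
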